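(* Let $n\ge 1$ and $m\ge 1$ be integers. The triangular region $T(m)$ in the hexagonal lattice admits a signed tiling by $n$-in-line polyominoes ($n$-bones) if and only if $$m \equiv -1 \pmod{n^2}\qquad\text{or}\qquad m\equiv 0 \pmod{n^2}.$$
   Context: The cells of the hexagonal lattice are identified with the points of $\mathbb{Z}^2$, where the cell $(p,q)$ is adjacent to the six cells $(p,q)\pm(1,0)$, $(p,q)\pm(0,1)$, $(p,q)\pm(1,-1)$. An $n$-bone ($n$-in-line polyomino, or polyhex) is a set of $n$ consecutive cells in a line, i.e. any translate by a vector of $\mathbb{Z}^2$ of one of the three sets $\{(i,0): 0\le i\le n-1\}$, $\{(0,i): 0\le i\le n-1\}$, $\{(n-1-i,i): 0\le i\le n-1\}$. The triangular region $T(m)$ of side-length $m$ is the set of cells $\{(i,j)\in\mathbb{Z}^2 : i\ge 0,\ j\ge 0,\ i+j\le m-1\}$. A finite region $P\subset\mathbb{Z}^2$ admits a signed tiling by $n$-bones if the indicator function of $P$ on $\mathbb{Z}^2$ is a finite linear combination, with (positive or negative) integer coefficients, of indicator functions of $n$-bones. *)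

theory Defs
  imports "HOL-Library.Product_Plus" "HOL-Library.Indicator_Function" "HOL-Number_Theory.Cong"
begin

(* The pair (p, q) names a cell of the hexagonal lattice; its six neighbours are
   (p, q) \<plusminus> (1, 0), (p, q) \<plusminus> (0, 1) and (p, q) \<plusminus> (1, -1). *)
type_synonym cell = "int \<times> int"

definition base_bones :: "nat \<Rightarrow> cell set set" where
  "base_bones n =
    {{(i, 0) |i. 0 \<le> i \<and> i \<le> int n - 1},
     {(0, i) |i. 0 \<le> i \<and> i \<le> int n - 1},
     {(int n - 1 - i, i) |i. 0 \<le> i \<and> i \<le> int n - 1}}"

definition bones :: "nat \<Rightarrow> cell set set" where
  "bones n = {(\<lambda>c. c + v) ` b |b v. b \<in> base_bones n}"

definition triangle :: "nat \<Rightarrow> cell set" where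
  "triangle m = {(i, j). i \<ge> 0 \<and> j \<ge> 0 \<and> i + j \<le> int m - 1}"

(* The finite set B contains the bones that may have a nonzero coefficient. *)
definition admits_signed_tiling :: "cell set \<Rightarrow> cell set set \<Rightarrow> bool" where
  "admits_signed_tiling P tiles \<longleftrightarrow>
    (\<exists>B (w :: cell set \<Rightarrow> int). finite B \<and> B \<subseteq> tiles \<and>
      (\<forall>c. indicator P c = (\<Sum>b\<in>B. w b * indicator b c)))"

end

theory Submission
  imports Defs
begin

text \<open>
  Work modulo the group spanned by the indicator functions of bones, and write \<open>T(m)\<close> for the
  indicator function of the triangle of side \<open>m\<close>. Removing one of its sides from \<open>T(n)\<close> removes
  a bone and leaves a translate of \<open>T(n - 1)\<close>. So \<open>T(n)\<close> is congruent to \<open>T(n - 1)\<close> and to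
  the translate of \<open>T(n - 1)\<close> by \<open>(1, 0)\<close>. Hence \<open>T(n)\<close> is congruent to its own translates by
  \<open>(k, 0)\<close>. Two consequences follow.

  \<^item> The sum of the translates of \<open>T(n)\<close> by \<open>(0, 0), \<dots>, (n - 1, 0)\<close> is a sum of bones, so
    \<open>n T(n)\<close> is congruent to \<open>0\<close>.
  \<^item> The part of \<open>T(m + n)\<close> outside \<open>T(m)\<close> is a translate of \<open>T(n)\<close> together with \<open>m\<close> bones, so
    \<open>T(q n + r)\<close> is congruent to \<open>T(r) + q T(n)\<close>.

  If \<open>m\<close> is \<open>0\<close> or \<open>-1\<close> modulo \<open>n\<^sup>2\<close>, then \<open>T(m)\<close> is therefore congruent to a multiple of
  \<open>n T(n)\<close>, and so to \<open>0\<close>; the case \<open>-1\<close> uses \<open>T(n - 1) \<equiv> T(n)\<close>.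

  Conversely, a weight on the cells whose sum over every bone is divisible by \<open>k\<close> has a sum over
  every tileable region that is divisible by \<open>k\<close>. Two weights, both periodic modulo \<open>n\<close>, suffice.

  \<^item> The hexagon weight puts alternating signs on the six neighbours of the cell \<open>(-1, 0)\<close>. Its
    sum over every bone is \<open>0\<close>, hence it vanishes on \<open>T(n)\<close>, a torsion element; and it is \<open>1\<close> on
    \<open>T(r)\<close> for \<open>1 \<le> r \<le> n - 2\<close>. This forces \<open>r\<close> to be \<open>0\<close> or \<open>n - 1\<close>.
  \<^item> The column weight is \<open>1\<close> on the columns \<open>i \<equiv> 0\<close> and \<open>-1\<close> on the columns \<open>i \<equiv> 1\<close>. Its
    sum over every bone is divisible by \<open>n\<close>, and for \<open>n \<ge> 2\<close> it is \<open>1\<close> on \<open>T(n)\<close>.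
    So \<open>T(n)\<close> has order exactly \<open>n\<close>, which determines \<open>q\<close> modulo \<open>n\<close> in either case.
\<close>

section \<open>The group spanned by the bones\<close>

text \<open>The integer combinations of indicator functions of \<open>n\<close>-bones, built up one bone at a time.\<close>

inductive bone_span :: "nat \<Rightarrow> (cell \<Rightarrow> int) \<Rightarrow> bool" for n where
  zero: "bone_span n (\<lambda>c. 0)"
| add_bone: "bone_span n g \<Longrightarrow> b \<in> bones n \<Longrightarrow> bone_span n (\<lambda>c. g c + k * indicator b c)"

lemma bone_span_bone: "b \<in> bones n \<Longrightarrow> bone_span n (indicator b)"
  using add_bone[OF zero, of b n 1] by simp

lemma bone_span_add:
  assumes "bone_span n g" "bone_span n h"
  shows "bone_span n (\<lambda>c. g c + h c)"
  using assms(2)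
proof induction
  case zero
  then show ?case using assms(1) by simp
next
  case (add_bone h b k)
  from bone_span.add_bone[OF add_bone.IH add_bone.hyps(2), of k] show ?case
    by (simp add: add.assoc)
qed

lemma bone_span_scale:
  assumes "bone_span n g"
  shows "bone_span n (\<lambda>c. a * g c)"
  using assms
proof induction
  case zero
  then show ?case using bone_span.zero by simp
next
  case (add_bone h b k)
  from bone_span.add_bone[OF add_bone.IH add_bone.hyps(2), of "a * k"] show ?case
    by (simp add: algebra_simps)
qed

lemma bone_span_diff:
  assumes "bone_span n g" "bone_span n h"
  shows "bone_span n (\<lambda>c. g c - h c)"
  using bone_span_add[OF assms(1) bone_span_scale[OF assms(2), of "-1"]] by simp

lemma bone_span_sum:
  assumes "finite A" "\<And>x. x \<in> A \<Longrightarrow> bone_span n (g x)"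
  shows "bone_span n (\<lambda>c. \<Sum>x\<in>A. g x c)"
  using assms by (induction A rule: finite_induct) (auto intro: zero bone_span_add)

lemma bones_translate: "b \<in> bones n \<Longrightarrow> (\<lambda>c. c + v) ` b \<in> bones n"
proof -
  assume "b \<in> bones n"
  then obtain b' u where "b' \<in> base_bones n" "b = (\<lambda>c. c + u) ` b'"
    unfolding bones_def by blast
  moreover from this have "(\<lambda>c. c + v) ` b = (\<lambda>c. c + (u + v)) ` b'"
    by (simp add: image_image add.assoc)
  ultimately show ?thesis unfolding bones_def by blast
qed

lemma indicator_translate:
  "indicator ((\<lambda>c. c + v) ` b) c = (indicator b (c - v) :: int)" for v :: cell
proof -
  have "c \<in> (\<lambda>c. c + v) ` b \<longleftrightarrow> c - v \<in> b"
    by (metis (no_types, lifting) diff_add_cancel add_diff_cancel imageE imageI)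
  then show ?thesis by (simp add: indicator_def)
qed

lemma bone_span_translate:
  assumes "bone_span n g"
  shows "bone_span n (\<lambda>c. g (c - v))"
  using assms
proof induction
  case zero
  show ?case by (rule bone_span.zero)
next
  case (add_bone h b k)
  from bone_span.add_bone[OF add_bone.IH bones_translate[OF add_bone.hyps(2)], of k v] show ?case
    by (simp add: indicator_translate)
qed

lemma admits_signed_tiling_iff_bone_span:
  "admits_signed_tiling P (bones n) \<longleftrightarrow> bone_span n (indicator P)"
proof
  assume "admits_signed_tiling P (bones n)"
  then obtain B w where B: "finite B" "B \<subseteq> bones n"
    and P: "\<And>c. indicator P c = (\<Sum>b\<in>B. w b * indicator b c :: int)"
    unfolding admits_signed_tiling_def by blast
  have "bone_span n (\<lambda>c. \<Sum>b\<in>B. w b * indicator b c)"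
    using B by (intro bone_span_sum bone_span_scale bone_span_bone) auto
  then show "bone_span n (indicator P)"
    by (simp flip: P)
next
  have "\<exists>B w. finite B \<and> B \<subseteq> bones n \<and> (\<forall>c. g c = (\<Sum>b\<in>B. w b * indicator b c))"
    if "bone_span n g" for g
    using that
  proof induction
    case zero
    show ?case by (intro exI[of _ "{}"]) auto
  next
    case (add_bone g b k)
    then obtain B w where B: "finite B" "B \<subseteq> bones n"
      and g: "\<And>c. g c = (\<Sum>b\<in>B. w b * indicator b c)"
      by blast
    \<comment> \<open>The bone \<open>b\<close> may already occur in \<open>B\<close>, so the default coefficient \<open>0\<close> is made explicit.\<close>
    define w' where "w' x = (if x \<in> B then w x else 0) + (if x = b then k else 0)" for x
    have "g c + k * indicator b c = (\<Sum>x\<in>insert b B. w' x * indicator x c)" for c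
    proof -
      have "(\<Sum>x\<in>insert b B. w' x * indicator x c) =
          (\<Sum>x\<in>insert b B. if x \<in> B then w x * indicator x c else 0) +
          (\<Sum>x\<in>insert b B. if x = b then k * indicator x c else 0)"
        unfolding sum.distrib[symmetric] by (rule sum.cong) (auto simp: w'_def algebra_simps)
      also have "(\<Sum>x\<in>insert b B. if x \<in> B then w x * indicator x c else 0) = g c"
        unfolding g by (rule sum.mono_neutral_cong_right) (use B in auto)
      finally show ?thesis using B by simp
    qed
    then show ?case
      using B add_bone.hyps(2) by (intro exI[of _ "insert b B"] exI[of _ w']) auto
  qed
  then show "bone_span n (indicator P) \<Longrightarrow> admits_signed_tiling P (bones n)"
    unfolding admits_signed_tiling_def by blast
qed

section \<open>Bones in coordinates\<close>

lemma translate_Collect: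
  "(\<lambda>c. c + v) ` {(f i, g i) |i. P i} = {(f i + fst v, g i + snd v) |i. P i}"
  for v :: cell
  by (cases v) (auto simp: image_iff plus_prod_def)

lemma bones_cases:
  assumes "b \<in> bones n"
  obtains (row) x y where "b = {(x + i, y) |i. 0 \<le> i \<and> i < int n}"
    | (column) x y where "b = {(x, y + i) |i. 0 \<le> i \<and> i < int n}"
    | (diagonal) x y where "b = {(x - i, y + i) |i. 0 \<le> i \<and> i < int n}"
proof -
  from assms obtain b' v where b': "b' \<in> base_bones n" and b: "b = (\<lambda>c. c + v) ` b'"
    unfolding bones_def by blast
  consider "b' = {(i, 0) |i. 0 \<le> i \<and> i \<le> int n - 1}"
    | "b' = {(0, i) |i. 0 \<le> i \<and> i \<le> int n - 1}"
    | "b' = {(int n - 1 - i, i) |i. 0 \<le> i \<and> i \<le> int n - 1}"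
    using b' unfolding base_bones_def by blast
  then show ?thesis
  proof cases
    case 1
    then have "b = {(fst v + i, snd v) |i. 0 \<le> i \<and> i < int n}"
      unfolding b by (simp add: translate_Collect add.commute)
    then show ?thesis by (rule row)
  next
    case 2
    then have "b = {(fst v, snd v + i) |i. 0 \<le> i \<and> i < int n}"
      unfolding b by (simp add: translate_Collect add.commute)
    then show ?thesis by (rule column)
  next
    case 3
    then have "b = {(int n - 1 + fst v - i, snd v + i) |i. 0 \<le> i \<and> i < int n}"
      unfolding b by (simp add: translate_Collect add_diff_eq diff_add_eq add.commute)
    then show ?thesis by (rule diagonal)
  qed
qed

lemma row_bone: "{(x + i, y) |i. 0 \<le> i \<and> i < int n} \<in> bones n"
proof -
  have "(\<lambda>c. c + (x, y)) ` {(i, 0) |i. 0 \<le> i \<and> i \<le> int n - 1} \<in> bones n"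
    unfolding bones_def base_bones_def by blast
  then show ?thesis by (simp add: translate_Collect add.commute)
qed

lemma column_bone: "{(x, y + i) |i. 0 \<le> i \<and> i < int n} \<in> bones n"
proof -
  have "(\<lambda>c. c + (x, y)) ` {(0, i) |i. 0 \<le> i \<and> i \<le> int n - 1} \<in> bones n"
    unfolding bones_def base_bones_def by blast
  then show ?thesis by (simp add: translate_Collect add.commute)
qed

lemma diagonal_bone: "{(x - i, y + i) |i. 0 \<le> i \<and> i < int n} \<in> bones n"
proof -
  have "(\<lambda>c. c + (x - int n + 1, y)) ` {(int n - 1 - i, i) |i. 0 \<le> i \<and> i \<le> int n - 1} \<in> bones n"
    unfolding bones_def base_bones_def by blast
  then show ?thesis by (simp add: translate_Collect add_diff_eq diff_add_eq add.commute)
qed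

section \<open>Triangles modulo bones\<close>

text \<open>The indicator function of the triangle of side \<open>m\<close>; it vanishes for \<open>m = 0\<close>.\<close>

abbreviation tri :: "nat \<Rightarrow> cell \<Rightarrow> int" where
  "tri m \<equiv> indicator (triangle m)"

lemma triangle_eq_Sigma: "triangle m = (SIGMA i:{0..<int m}. {0..<int m - i})"
  unfolding triangle_def by auto

lemma finite_triangle: "finite (triangle m)"
  unfolding triangle_eq_Sigma by (intro finite_SigmaI) auto

lemma tri_side_diagonal:
  assumes "n \<ge> 1"
  shows "bone_span n (\<lambda>c. tri n c - tri (n - 1) c)"
proof -
  let ?b = "{(int n - 1 - i, 0 + i) |i. 0 \<le> i \<and> i < int n}"
  have "(\<lambda>c. tri n c - tri (n - 1) c) = indicator ?b"
    using assms by (intro ext) (auto simp: triangle_def indicator_def of_nat_diff)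
  then show ?thesis
    using bone_span_bone[OF diagonal_bone[where x = "int n - 1" and y = 0 and n = n]] by metis
qed

lemma tri_side_column:
  assumes "n \<ge> 1"
  shows "bone_span n (\<lambda>c. tri n c - tri (n - 1) (c - (1, 0)))"
proof -
  let ?b = "{(0, 0 + i) |i. 0 \<le> i \<and> i < int n}"
  have "(\<lambda>c. tri n c - tri (n - 1) (c - (1, 0))) = indicator ?b"
    using assms by (intro ext) (auto simp: triangle_def indicator_def of_nat_diff)
  then show ?thesis
    using bone_span_bone[OF column_bone[where x = 0 and y = 0 and n = n]] by metis
qed

lemma tri_translate:
  assumes "n \<ge> 1"
  shows "bone_span n (\<lambda>c. tri n (c - (int k, 0)) - tri n c)"
proof (induction k)
  case 0
  show ?case using zero by (simp flip: zero_prod_def)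
next
  case (Suc k)
  have step: "bone_span n (\<lambda>c. tri n (c - (1, 0)) - tri n c)"
    using bone_span_diff[OF bone_span_translate[OF tri_side_diagonal[OF assms], of "(1, 0)"]
        tri_side_column[OF assms]]
    by simp
  have "c - (1, 0) - (int k, 0) = c - (int (Suc k), 0)" for c :: cell
    by (cases c) simp
  with bone_span_add[OF bone_span_translate[OF Suc, of "(1, 0)"] step] show ?case
    by (simp only:) simp
qed

text \<open>The sum of \<open>n\<close> consecutive translates of \<open>tri n\<close> is also the sum, over the cells \<open>a\<close> of the
  triangle, of the row bones starting at \<open>a\<close>.\<close>

lemma tri_torsion:
  assumes "n \<ge> 1"
  shows "bone_span n (\<lambda>c. int n * tri n c)"
proof -
  have "bone_span n (\<lambda>c. \<Sum>a\<in>triangle n. indicator {(fst a + i, snd a) |i. 0 \<le> i \<and> i < int n} c)"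
    by (intro bone_span_sum finite_triangle bone_span_bone row_bone)
  moreover have "(\<Sum>a\<in>triangle n. indicator {(fst a + i, snd a) |i. 0 \<le> i \<and> i < int n} c) =
      (\<Sum>k<n. tri n (c - (int k, 0)))" for c
  proof -
    have "indicator {(fst a + i, snd a) |i. 0 \<le> i \<and> i < int n} c =
        (\<Sum>k<n. if a = c - (int k, 0) then 1 else 0 :: int)" for a
    proof (cases "\<exists>k<n. a = c - (int k, 0)")
      case True
      then obtain k where k: "k < n" "a = c - (int k, 0)" by blast
      then have "(\<Sum>j<n. if a = c - (int j, 0) then 1 else 0 :: int) = (\<Sum>j<n. if k = j then 1 else 0)"
        by (intro sum.cong) (auto simp: prod_eq_iff)
      moreover have "c \<in> {(fst a + i, snd a) |i. 0 \<le> i \<and> i < int n}"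
        using k by (auto simp: prod_eq_iff intro!: exI[of _ "int k"])
      ultimately show ?thesis using k(1) by simp
    next
      case False
      have "c \<notin> {(fst a + i, snd a) |i. 0 \<le> i \<and> i < int n}"
      proof
        assume "c \<in> {(fst a + i, snd a) |i. 0 \<le> i \<and> i < int n}"
        then obtain i where "0 \<le> i" "i < int n" "c = (fst a + i, snd a)" by blast
        then have "nat i < n \<and> a = c - (int (nat i), 0)"
          by (auto simp: prod_eq_iff)
        with False show False by blast
      qed
      with False show ?thesis by simp
    qed
    then have "(\<Sum>a\<in>triangle n. indicator {(fst a + i, snd a) |i. 0 \<le> i \<and> i < int n} c) =
        (\<Sum>a\<in>triangle n. \<Sum>k<n. if a = c - (int k, 0) then 1 else 0 :: int)"
      by (rule sum.cong[OF refl])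
    also have "\<dots> = (\<Sum>k<n. \<Sum>a\<in>triangle n. if a = c - (int k, 0) then 1 else 0)"
      by (rule sum.swap)
    also have "\<dots> = (\<Sum>k<n. tri n (c - (int k, 0)))"
      by (intro sum.cong) (simp_all add: finite_triangle indicator_def)
    finally show ?thesis .
  qed
  ultimately have "bone_span n (\<lambda>c. \<Sum>k<n. tri n (c - (int k, 0)))"
    by simp
  from bone_span_diff[OF this bone_span_sum[OF _ tri_translate[OF assms], of "{..<n}" "\<lambda>k. k"]]
  show ?thesis by (simp add: sum_subtractf)
qed

lemma tri_add:
  assumes "n \<ge> 1"
  shows "bone_span n (\<lambda>c. tri (m + n) c - (tri m c + tri n c))"
proof -
  \<comment> \<open>The part of the strip \<open>m \<le> i + j < m + n\<close> in column \<open>k < m\<close> is one bone; the remaining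
    columns form a translate of the triangle of side \<open>n\<close>.\<close>
  let ?b = "\<lambda>k. {(int k, (int m - int k) + i) |i. 0 \<le> i \<and> i < int n}"
  have bones: "bone_span n (\<lambda>c. \<Sum>k<m. indicator (?b k) c)"
    by (intro bone_span_sum bone_span_bone column_bone) auto
  have split: "tri (m + n) c = tri m c + tri n (c - (int m, 0)) + (\<Sum>k<m. indicator (?b k) c)" for c
  proof -
    obtain x y where c: "c = (x, y)" by (cases c)
    have mem: "c \<in> ?b k \<longleftrightarrow> x = int k \<and> int m - x \<le> y \<and> y < int m - x + int n" for k
      unfolding c by (auto intro: exI[of _ "y - (int m - int k)"])
    have "(\<Sum>k<m. indicator (?b k) c) = (if 0 \<le> x \<and> x < int m \<and> int m - x \<le> y \<and> y < int m - x + int n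
        then 1 else 0 :: int)"
    proof (cases "0 \<le> x \<and> x < int m \<and> int m - x \<le> y \<and> y < int m - x + int n")
      case True
      then have "(\<Sum>k<m. indicator (?b k) c) = (\<Sum>k<m. if nat x = k then 1 else 0 :: int)"
        by (intro sum.cong refl) (simp only: indicator_def mem, auto)
      also have "\<dots> = 1" using True by (simp add: nat_less_iff)
      finally show ?thesis using True by simp
    next
      case False
      then have "(\<Sum>k<m. indicator (?b k) c) = (0 :: int)"
        by (intro sum.neutral ballI) (simp only: indicator_def mem, auto)
      with False show ?thesis by simp
    qed
    then show ?thesis unfolding c by (auto simp: indicator_def triangle_def)
  qed
  show ?thesis
    using bone_span_add[OF bones tri_translate[OF assms, of m]] by (simp add: split algebra_simps)
qed

lemma tri_mult_add:
  assumes "n \<ge> 1"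
  shows "bone_span n (\<lambda>c. tri (q * n + r) c - (tri r c + int q * tri n c))"
proof (induction q)
  case 0
  show ?case using zero by simp
next
  case (Suc q)
  show ?case
    using bone_span_add[OF tri_add[OF assms, of "q * n + r"] Suc] by (simp add: algebra_simps)
qed

section \<open>Weights on cells\<close>

text \<open>The pairing of \<open>g\<close> with \<open>f\<close> is a sum over the support of \<open>g\<close>. Taking it over all sufficiently
  large finite sets instead makes it additive in \<open>g\<close>, even though the support is not.\<close>

lemma bone_span_weight:
  assumes "bone_span n g" and "\<And>b. b \<in> bones n \<Longrightarrow> k dvd sum f b"
  shows "\<exists>A. finite A \<and> (\<forall>A'. finite A' \<longrightarrow> A \<subseteq> A' \<longrightarrow> k dvd (\<Sum>c\<in>A'. g c * f c))"
  using assms(1)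
proof induction
  case zero
  show ?case by auto
next
  case (add_bone g b a)
  then obtain A where A: "finite A"
    "\<And>A'. finite A' \<Longrightarrow> A \<subseteq> A' \<Longrightarrow> k dvd (\<Sum>c\<in>A'. g c * f c)"
    by blast
  have "finite b"
  proof -
    have *: "finite {(h i :: cell) |i. 0 \<le> i \<and> i < int n}" for h
      by (simp add: setcompr_eq_image flip: atLeastLessThan_iff)
    from add_bone.hyps(2) show ?thesis
      by (cases rule: bones_cases) (simp_all add: *)
  qed
  have "k dvd (\<Sum>c\<in>A'. (g c + a * indicator b c) * f c)" if "finite A'" "A \<union> b \<subseteq> A'" for A'
  proof -
    have "(\<Sum>c\<in>A'. indicator b c * f c) = sum f b"
      using that by (intro sum.mono_neutral_cong_right) auto
    then have "(\<Sum>c\<in>A'. (g c + a * indicator b c) * f c) = (\<Sum>c\<in>A'. g c * f c) + a * sum f b"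
      by (simp add: distrib_right sum.distrib mult.assoc flip: sum_distrib_left)
    then show ?thesis
      using A(2)[of A'] that assms(2)[OF add_bone.hyps(2)] by simp
  qed
  then show ?case
    using A(1) \<open>finite b\<close> by (intro exI[of _ "A \<union> b"]) auto
qed

lemma bone_span_weight_combination:
  assumes span: "bone_span n (\<lambda>c. x * indicator P c + y * indicator Q c)"
    and weight: "\<And>b. b \<in> bones n \<Longrightarrow> k dvd sum f b"
    and fin: "finite P" "finite Q"
  shows "k dvd x * sum f P + y * sum f Q"
proof -
  obtain A where A: "finite A" "\<And>A'. finite A' \<Longrightarrow> A \<subseteq> A' \<Longrightarrow>
      k dvd (\<Sum>c\<in>A'. (x * indicator P c + y * indicator Q c) * f c)"
    using bone_span_weight[OF span weight] by blast
  let ?A = "A \<union> P \<union> Q"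
  have "(\<Sum>c\<in>?A. indicator P c * f c) = sum f P" "(\<Sum>c\<in>?A. indicator Q c * f c) = sum f Q"
    using A(1) fin by (auto intro!: sum.mono_neutral_cong_right)
  then have "(\<Sum>c\<in>?A. (x * indicator P c + y * indicator Q c) * f c) = x * sum f P + y * sum f Q"
    by (simp add: distrib_right sum.distrib mult.assoc flip: sum_distrib_left)
  then show ?thesis using A(2)[of ?A] A(1) fin by auto
qed

text \<open>The indicator function of the multiples of \<open>n\<close>, from which the periodic weights are built.\<close>

definition mult_ind :: "nat \<Rightarrow> int \<Rightarrow> int" where
  "mult_ind n i = (if int n dvd i then 1 else 0)"

lemma sum_mult_ind:
  assumes "n \<ge> 1"
  shows "(\<Sum>i\<in>{0..<int n}. mult_ind n (a + i)) = 1"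
proof -
  have "int n dvd a + i \<longleftrightarrow> i = (- a) mod int n" if "i \<in> {0..<int n}" for i
  proof -
    have "int n dvd a + i \<longleftrightarrow> i mod int n = (- a) mod int n"
      by (simp add: mod_eq_dvd_iff add.commute)
    with that show ?thesis by simp
  qed
  then have "(\<Sum>i\<in>{0..<int n}. mult_ind n (a + i)) =
      (\<Sum>i\<in>{0..<int n}. if i = (- a) mod int n then 1 else 0)"
    unfolding mult_ind_def by (intro sum.cong) auto
  also have "\<dots> = 1" using assms by simp
  finally show ?thesis .
qed

lemma mult_ind_minus: "mult_ind n (a - i) = mult_ind n (- a + i)"
  unfolding mult_ind_def by (metis dvd_minus_iff minus_diff_eq uminus_add_conv_diff)

lemma sum_mult_ind_minus:
  assumes "n \<ge> 1"
  shows "(\<Sum>i\<in>{0..<int n}. mult_ind n (a - i)) = 1"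
  by (simp only: mult_ind_minus sum_mult_ind[OF assms])

lemma sum_mult_ind_diagonal:
  assumes "n \<ge> 1"
  shows "(\<Sum>i\<in>{0..<int n}. mult_ind n (a - i) * mult_ind n (b + i)) = mult_ind n (a + b)"
proof -
  \<comment> \<open>When \<open>n\<close> divides \<open>b + i\<close>, it divides \<open>a - i\<close> iff it divides the sum \<open>a + b\<close>.\<close>
  have "mult_ind n (a - i) * mult_ind n (b + i) = mult_ind n (a + b) * mult_ind n (b + i)" for i
  proof (cases "int n dvd b + i")
    case True
    then have "int n dvd a - i \<longleftrightarrow> int n dvd (a - i) + (b + i)"
      by (simp only: dvd_add_left_iff)
    then show ?thesis by (simp add: mult_ind_def)
  qed (simp add: mult_ind_def)
  then show ?thesis
    using sum_mult_ind[OF assms, of b] by (simp only: mult_1_right flip: sum_distrib_left)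
qed

lemma sum_bone_cases:
  assumes "b \<in> bones n"
  obtains (row) x y where "\<And>f :: cell \<Rightarrow> int. sum f b = (\<Sum>i\<in>{0..<int n}. f (x + i, y))"
    | (column) x y where "\<And>f :: cell \<Rightarrow> int. sum f b = (\<Sum>i\<in>{0..<int n}. f (x, y + i))"
    | (diagonal) x y where "\<And>f :: cell \<Rightarrow> int. sum f b = (\<Sum>i\<in>{0..<int n}. f (x - i, y + i))"
proof -
  have *: "{h i |i. 0 \<le> i \<and> i < int n} = h ` {0..<int n}" for h :: "int \<Rightarrow> cell"
    by auto
  from assms show ?thesis
  proof (cases rule: bones_cases)
    case (row x y)
    then show ?thesis
      by (intro that(1)[of x y]) (simp add: * sum.reindex inj_on_def)
  next
    case (column x y)
    then show ?thesis
      by (intro that(2)[of x y]) (simp add: * sum.reindex inj_on_def)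
  next
    case (diagonal x y)
    then show ?thesis
      by (intro that(3)[of x y]) (simp add: * sum.reindex inj_on_def)
  qed
qed

text \<open>The weight that is \<open>1\<close> on the columns \<open>i \<equiv> 0\<close> and \<open>-1\<close> on the columns \<open>i \<equiv> 1\<close> modulo \<open>n\<close>
  (and identically \<open>0\<close> for \<open>n = 1\<close>, where the two classes coincide).\<close>

definition column_weight :: "nat \<Rightarrow> cell \<Rightarrow> int" where
  "column_weight n = (\<lambda>(i, j). mult_ind n i - mult_ind n (i - 1))"

lemma column_weight_bone:
  assumes "n \<ge> 1" "b \<in> bones n"
  shows "int n dvd sum (column_weight n) b"
  using assms(2)
proof (cases rule: sum_bone_cases)
  case (row x y)
  have "sum (column_weight n) b =
      (\<Sum>i\<in>{0..<int n}. mult_ind n (x + i)) - (\<Sum>i\<in>{0..<int n}. mult_ind n ((x - 1) + i))"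
    by (simp add: row column_weight_def sum_subtractf algebra_simps)
  then show ?thesis using assms(1) by (simp only: sum_mult_ind diff_self dvd_0_right)
next
  case (column x y)
  then show ?thesis by (simp add: column_weight_def)
next
  case (diagonal x y)
  have "sum (column_weight n) b =
      (\<Sum>i\<in>{0..<int n}. mult_ind n (x - i)) - (\<Sum>i\<in>{0..<int n}. mult_ind n ((x - 1) - i))"
    by (simp add: diagonal column_weight_def sum_subtractf algebra_simps)
  then show ?thesis using assms(1) by (simp only: sum_mult_ind_minus diff_self dvd_0_right)
qed

lemma column_weight_triangle:
  assumes "n \<ge> 2"
  shows "sum (column_weight n) (triangle n) = 1"
proof -
  have small: "mult_ind n i = (if i = 0 then 1 else 0)" "mult_ind n (i - 1) = (if i = 1 then 1 else 0)"
    if "i \<in> {0..<int n}" for i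
    using that assms zdvd_imp_le[of "int n" i] zdvd_imp_le[of "int n" "i - 1"]
    by (cases "i = 0"; force simp: mult_ind_def)+
  have "sum (column_weight n) (triangle n) =
      (\<Sum>i\<in>{0..<int n}. \<Sum>j\<in>{0..<int n - i}. mult_ind n i - mult_ind n (i - 1))"
    unfolding triangle_eq_Sigma column_weight_def by (rule sum.Sigma[symmetric]) auto
  also have "\<dots> = (\<Sum>i\<in>{0..<int n}. (int n - i) * (mult_ind n i - mult_ind n (i - 1)))"
    by (intro sum.cong) auto
  also have "\<dots> = (\<Sum>i\<in>{0..<int n}. (if i = 0 then int n else 0) - (if i = 1 then int n - 1 else 0))"
    by (intro sum.cong) (auto simp: small)
  also have "\<dots> = 1"
    using assms by (simp add: sum_subtractf)
  finally show ?thesis .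
qed

text \<open>The \<open>n\<close>-periodic weight with alternating signs on the six neighbours of the cell \<open>(-1, 0)\<close>,
  in cyclic order from \<open>(0, 0)\<close>; the signs of neighbours that coincide modulo \<open>n\<close> add up.\<close>

definition hexagon_weight :: "nat \<Rightarrow> cell \<Rightarrow> int" where
  "hexagon_weight n = (\<lambda>(i, j).
      mult_ind n i * mult_ind n j
    - mult_ind n (i + 1) * mult_ind n (j - 1)
    + mult_ind n (i + 2) * mult_ind n (j - 1)
    - mult_ind n (i + 2) * mult_ind n j
    + mult_ind n (i + 1) * mult_ind n (j + 1)
    - mult_ind n i * mult_ind n (j + 1))"

lemma hexagon_weight_bone:
  assumes "n \<ge> 1" "b \<in> bones n"
  shows "sum (hexagon_weight n) b = 0"
  using assms(2)
proof (cases rule: sum_bone_cases)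
  case (row x y)
  have "(\<Sum>i\<in>{0..<int n}. mult_ind n (x + i + d) * z) = z" for d z
    using sum_mult_ind[OF assms(1), of "x + d"] by (simp add: ac_simps flip: sum_distrib_left)
  from this[of 0] this[of 1] this[of 2] show ?thesis
    by (simp add: row hexagon_weight_def sum_subtractf sum.distrib)
next
  case (column x y)
  have shift: "(\<Sum>i\<in>{0..<int n}. z * mult_ind n (y + i + d)) = z" for d z
    using sum_mult_ind[OF assms(1), of "y + d"] by (simp add: ac_simps flip: sum_distrib_left)
  from shift[of _ 0] shift[of _ 1] shift[of _ "-1"] show ?thesis
    by (simp add: column hexagon_weight_def sum_subtractf sum.distrib)
next
  case (diagonal x y)
  have shift: "(\<Sum>i\<in>{0..<int n}. mult_ind n (x - i + d) * mult_ind n (y + i + e)) =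
      mult_ind n (x + y + (d + e))" for d e
    using sum_mult_ind_diagonal[OF assms(1), of "x + d" "y + e"] by (simp add: algebra_simps)
  from shift[of 0 0] shift[of 1 "-1"] shift[of 2 "-1"] shift[of 2 0] shift[of 1 1] shift[of 0 1]
  show ?thesis
    by (simp add: diagonal hexagon_weight_def sum_subtractf sum.distrib)
qed

text \<open>The weight has exact sum \<open>0\<close> over bones, so its integer value on the torsion element
  \<open>tri n\<close> is \<open>0\<close>.\<close>

lemma hexagon_weight_triangle_self:
  assumes "n \<ge> 1"
  shows "sum (hexagon_weight n) (triangle n) = 0"
proof -
  have "bone_span n (\<lambda>c. int n * tri n c + 0 * tri n c)"
    using tri_torsion[OF assms] by simp
  from bone_span_weight_combination[OF this, of 0 "hexagon_weight n"] show ?thesis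
    using assms hexagon_weight_bone finite_triangle by simp
qed

text \<open>Modulo \<open>n\<close>, a small triangle meets the hexagon only in the corner \<open>(0, 0)\<close>: each other cell
  of the hexagon has a coordinate congruent to \<open>-1\<close> or \<open>-2\<close>.\<close>

lemma hexagon_weight_triangle_small:
  assumes "1 \<le> r" "r + 2 \<le> n"
  shows "sum (hexagon_weight n) (triangle r) = 1"
proof -
  have no: "mult_ind n i = 0" if "0 < i" "i < int n" for i
    using that zdvd_not_zless[of i "int n"] by (simp add: mult_ind_def)
  have "hexagon_weight n c = (if c = (0, 0) then 1 else 0)" if "c \<in> triangle r" for c
  proof -
    obtain i j where c: "c = (i, j)" by (cases c)
    with that assms have ij: "0 \<le> i" "0 \<le> j" "i + 2 < int n" "j + 2 < int n"
      by (auto simp: triangle_def)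
    then have "mult_ind n (i + 1) = 0" "mult_ind n (i + 2) = 0" "mult_ind n (j + 1) = 0"
      by (auto intro!: no)
    moreover have "mult_ind n i = (if i = 0 then 1 else 0)" "mult_ind n j = (if j = 0 then 1 else 0)"
      using ij no[of i] no[of j] by (auto simp: mult_ind_def)
    ultimately show ?thesis by (simp add: c hexagon_weight_def)
  qed
  then have "sum (hexagon_weight n) (triangle r) = (\<Sum>c\<in>triangle r. if c = (0, 0) then 1 else 0)"
    by (intro sum.cong) auto
  also have "\<dots> = 1"
    using assms by (simp add: finite_triangle) (simp add: triangle_def)
  finally show ?thesis .
qed

section \<open>The classification\<close>

text \<open>The order of \<open>tri n\<close> modulo bones is exactly \<open>n\<close>.\<close>

lemma bone_span_multiple_tri_iff:
  assumes "n \<ge> 1"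
  shows "bone_span n (\<lambda>c. k * tri n c) \<longleftrightarrow> int n dvd k"
proof
  assume "int n dvd k"
  then obtain t where "k = int n * t" by blast
  then show "bone_span n (\<lambda>c. k * tri n c)"
    using bone_span_scale[OF tri_torsion[OF assms], of t] by (simp add: ac_simps)
next
  assume span: "bone_span n (\<lambda>c. k * tri n c)"
  show "int n dvd k"
  proof (cases "n = 1")
    case False
    from span have "bone_span n (\<lambda>c. k * tri n c + 0 * tri n c)"
      by simp
    from bone_span_weight_combination[OF this column_weight_bone[OF assms]]
    have "int n dvd k * sum (column_weight n) (triangle n)"
      by (simp add: finite_triangle)
    then show ?thesis
      using column_weight_triangle[of n] assms False by simp
  qed simp
qed

lemma bone_span_cong:
  assumes "bone_span n (\<lambda>c. g c - h c)"
  shows "bone_span n g \<longleftrightarrow> bone_span n h"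
  using bone_span_add[OF assms, of h] bone_span_diff[OF _ assms, of g] by auto

theorem theorem13:
  fixes n m :: nat
  assumes "n \<ge> 1" and "m \<ge> 1"
  shows "admits_signed_tiling (triangle m) (bones n) \<longleftrightarrow>
    [int m = -1] (mod (int n)^2) \<or> [int m = 0] (mod (int n)^2)"
proof -
  define q r where "q = m div n" and "r = m mod n"
  have m: "m = q * n + r" and r: "r < n"
    using assms(1) by (simp_all add: q_def r_def)
  have n0: "int n \<noteq> 0" using assms(1) by simp
  have reduce: "bone_span n (tri m) \<longleftrightarrow> bone_span n (\<lambda>c. tri r c + int q * tri n c)"
    unfolding m by (rule bone_span_cong[OF tri_mult_add[OF assms(1)]])
  have rhs: "[int m = -1] (mod (int n)^2) \<longleftrightarrow> (int n)^2 dvd int m + 1"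
    "[int m = 0] (mod (int n)^2) \<longleftrightarrow> (int n)^2 dvd int m"
    by (simp_all add: cong_iff_dvd_diff)
  have zero_case: "bone_span n (tri m) \<longleftrightarrow> (int n)^2 dvd int m" if "r = 0"
  proof -
    have "tri r = (\<lambda>c. 0)"
      using that by (auto simp: triangle_def indicator_def)
    then have "bone_span n (tri m) \<longleftrightarrow> int n dvd int q"
      using reduce bone_span_multiple_tri_iff[OF assms(1)] by simp
    also have "\<dots> \<longleftrightarrow> (int n)^2 dvd int m"
      using that n0 by (simp add: m power2_eq_square)
    finally show ?thesis .
  qed
  have last_case: "bone_span n (tri m) \<longleftrightarrow> (int n)^2 dvd int m + 1" if "r = n - 1"
  proof -
    have "bone_span n (\<lambda>c. (int q + 1) * tri n c - (tri r c + int q * tri n c))"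
      using tri_side_diagonal[OF assms(1)] that by (simp add: algebra_simps)
    then have "bone_span n (tri m) \<longleftrightarrow> int n dvd int q + 1"
      using reduce bone_span_cong bone_span_multiple_tri_iff[OF assms(1)] by metis
    also have "\<dots> \<longleftrightarrow> (int n)^2 dvd (int q + 1) * int n"
      using n0 by (simp add: power2_eq_square)
    also have "(int q + 1) * int n = int m + 1"
      using that assms(1) by (simp add: m algebra_simps of_nat_diff)
    finally show ?thesis .
  qed
  have middle: "\<not> bone_span n (tri m)" if "r \<noteq> 0" "r \<noteq> n - 1"
  proof
    assume "bone_span n (tri m)"
    then have "bone_span n (\<lambda>c. 1 * tri r c + int q * tri n c)"
      using reduce by simp
    from bone_span_weight_combination[OF this, of 0 "hexagon_weight n"]
    have "sum (hexagon_weight n) (triangle r) + int q * sum (hexagon_weight n) (triangle n) = 0"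
      using hexagon_weight_bone[OF assms(1)] by (simp add: finite_triangle)
    then show False
      using hexagon_weight_triangle_self[OF assms(1)] hexagon_weight_triangle_small[of r n] that r
      by simp
  qed
  \<comment> \<open>Each congruence modulo \<open>n\<^sup>2\<close> already determines the remainder \<open>r\<close>.\<close>
  have r0: "r = 0" if "(int n)^2 dvd int m"
  proof -
    have "int n dvd int m"
      using that by (metis dvd_mult_left power2_eq_square)
    then show ?thesis by (simp add: r_def)
  qed
  have r1: "r = n - 1" if "(int n)^2 dvd int m + 1"
  proof -
    have "int n dvd int (m + 1)"
      using that by (metis dvd_mult_left of_nat_1 of_nat_add power2_eq_square)
    then have "n dvd q * n + (r + 1)"
      by (simp only: int_dvd_int_iff m add.assoc)
    then have "n dvd r + 1"
      by (simp only: dvd_add_right_iff dvd_triv_right)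
    then show ?thesis using r by (auto dest: dvd_imp_le)
  qed
  show ?thesis
    unfolding admits_signed_tiling_iff_bone_span rhs
    using zero_case last_case middle r0 r1 by metis
qed

end
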